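(* Let $n\ge 1$ and $0\le k\le n$ be integers, and let $\sigma\in\mathrm{GL}_n(\mathbb{C})$ be the cyclic shift map $\sigma(v_1,\dots,v_n)=(v_2,v_3,\dots,v_n,(-1)^{k-1}v_1)$, acting on $\mathrm{Gr}_{k,n}(\mathbb{C})$ by $V\mapsto\sigma(V)=\{\sigma(v):v\in V\}$. Then $\sigma$ has exactly $\binom{n}{k}$ fixed points on $\mathrm{Gr}_{k,n}(\mathbb{C})$, namely the subspaces $\mathrm{span}\{(1,z_j,z_j^2,\dots,z_j^{n-1}):1\le j\le k\}$ for any $k$ distinct $n$th roots $z_1,\dots,z_k\in\mathbb{C}$ of $(-1)^{k-1}$. Moreover, exactly one of these fixed points is totally nonnegative, namely the one obtained by taking $\{z_1,\dots,z_k\}$ to be the $k$ $n$th roots of $(-1)^{k-1}$ closest to $1$ on the unit circle, i.e. $\{z_1,\dots,z_k\}=\{e^{i(k-1-2j)\pi/n}:0\le j\le k-1\}$.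
   Context: $\mathrm{Gr}_{k,n}(\mathbb{C})$ is the set of $k$-dimensional subspaces of $\mathbb{C}^n$. For $V\in\mathrm{Gr}_{k,n}(\mathbb{C})$ represented as the row span of a $k\times n$ matrix $A$, and a $k$-subset $I\subseteq\{1,\dots,n\}$, the Plücker coordinate $\Delta_I(V)$ is the $k\times k$ minor of $A$ in columns $I$; these are well defined up to a common nonzero scalar. $V$ is totally nonnegative if, for some choice of this common scalar, $\Delta_I(V)\ge 0$ for all $k$-subsets $I$, and totally positive if $\Delta_I(V)>0$ for all $I$. *)

theory Defs
  imports
    Complex_Main
    "HOL-Library.Nonpos_Ints"
    "Jordan_Normal_Form.VS_Connect"
    "Jordan_Normal_Form.DL_Submatrix"
begin

text \<open>
  Vectors of \<open>\<complex>\<^sup>n\<close> are elements of \<^term>\<open>carrier_vec n :: complex vec set\<close>; coordinates and matrix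
  columns are indexed by \<open>0, \<dots>, n - 1\<close>. The sign \<open>(-1)\<^sup>k\<^sup>-\<^sup>1\<close> is an integer power, so that it is
  \<open>-1\<close> for \<open>k = 0\<close>.
\<close>

definition Gr :: "nat \<Rightarrow> nat \<Rightarrow> complex vec set set" where
  "Gr k n = {V. VectorSpace.subspace class_ring V (module_vec TYPE(complex) n) \<and>
     vectorspace.dim class_ring ((module_vec TYPE(complex) n)\<lparr>carrier := V\<rparr>) = k}"

definition represents :: "nat \<Rightarrow> nat \<Rightarrow> complex mat \<Rightarrow> complex vec set \<Rightarrow> bool" where
  "represents k n A V \<longleftrightarrow> A \<in> carrier_mat k n \<and> vec_space.row_space n A = V"

definition plucker :: "complex mat \<Rightarrow> nat set \<Rightarrow> complex" where
  "plucker A I = det (submatrix A UNIV I)"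

text \<open>The scalar \<open>c\<close> is the common nonzero scalar up to which Pluecker coordinates are defined.\<close>

definition totally_nonneg :: "nat \<Rightarrow> nat \<Rightarrow> complex vec set \<Rightarrow> bool" where
  "totally_nonneg k n V \<longleftrightarrow>
     (\<exists>A c. represents k n A V \<and> c \<noteq> 0 \<and>
        (\<forall>I. I \<subseteq> {..<n} \<and> card I = k \<longrightarrow> c * plucker A I \<in> \<real>\<^sub>\<ge>\<^sub>0))"

definition cyclic_shift :: "nat \<Rightarrow> nat \<Rightarrow> complex vec \<Rightarrow> complex vec" where
  "cyclic_shift k n v =
     vec n (\<lambda>i. if i + 1 < n then v $ (i + 1) else (-1) powi (int k - 1) * v $ 0)"

definition shift_fixed_points :: "nat \<Rightarrow> nat \<Rightarrow> complex vec set set" where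
  "shift_fixed_points k n = {V \<in> Gr k n. cyclic_shift k n ` V = V}"

definition sign_roots :: "nat \<Rightarrow> nat \<Rightarrow> complex set" where
  "sign_roots k n = {z. z ^ n = (-1) powi (int k - 1)}"

definition power_span :: "nat \<Rightarrow> complex set \<Rightarrow> complex vec set" where
  "power_span n Z =
     module.span class_ring (module_vec TYPE(complex) n) ((\<lambda>z. vec n (\<lambda>i. z ^ i)) ` Z)"

text \<open>
  On the unit circle, comparing distances to \<open>1\<close> in \<open>\<complex>\<close> is the same as comparing arc lengths.
\<close>

definition closest_sign_roots :: "nat \<Rightarrow> nat \<Rightarrow> complex set \<Rightarrow> bool" where
  "closest_sign_roots k n Z \<longleftrightarrow> Z \<subseteq> sign_roots k n \<and> card Z = k \<and>
     (\<forall>z\<in>Z. \<forall>w\<in>sign_roots k n - Z. dist z 1 \<le> dist w 1)"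

end

theory Submission
  imports Defs
begin

text \<open>
  The eigenvectors of the shift are the vectors \<open>(1, z, \<dots>, z\<^sup>n\<^sup>-\<^sup>1)\<close> for the \<open>n\<close> distinct roots \<open>z\<close> of
  \<open>z\<^sup>n = (-1)\<^sup>k\<^sup>-\<^sup>1\<close>, and they are orthogonal. Hence invariant subspaces are exactly the spans of sets of
  eigenvectors. For the roots closest to \<open>1\<close>, the Pluecker coordinates are generalised Vandermonde
  determinants that factor, up to a common scalar, into sines of angles in \<open>(0, \<pi>)\<close>, so this fixed
  point is totally positive. If another fixed point \<open>V\<close> had nonnegative coordinates, the Hermitian
  product of its Pluecker vector with the totally positive one would be nonzero. By Cauchy--Binet this
  product is the determinant of the matrix of Hermitian products between representing rows; it
  vanishes, since some eigenvector spanning the totally positive point is orthogonal to \<open>V\<close>.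
\<close>

section \<open>Orthogonality of the eigenvectors\<close>

lemma norm_sign_root:
  assumes "n \<ge> 1" "z \<in> sign_roots k n"
  shows "norm z = 1"
proof -
  have "norm z ^ n = 1"
    using assms(2) by (simp add: sign_roots_def norm_power_int flip: norm_power)
  with assms(1) show ?thesis
    using power_eq_imp_eq_base[of "norm z" n 1] by simp
qed

lemma sign_root_cnj:
  assumes "n \<ge> 1" "z \<in> sign_roots k n"
  shows "z * cnj z = 1"
  using norm_sign_root[OF assms] complex_norm_square[of z] by simp

text \<open>Since \<open>cnj w\<close> inverts \<open>w\<close>, the number \<open>z * cnj w\<close>
  is an \<open>n\<close>th root of unity, and the geometric sum of its powers vanishes unless it is
  1.\<close>

lemma sign_roots_orthogonal:
  assumes "n \<ge> 1" "z \<in> sign_roots k n" "w \<in> sign_roots k n"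
  shows "(\<Sum>i<n. (z * cnj w) ^ i) = (if z = w then of_nat n else 0)"
proof (cases "z = w")
  case True
  then show ?thesis using sign_root_cnj[OF assms(1,3)] by simp
next
  case False
  have "z * cnj w \<noteq> 1"
    using False sign_root_cnj[OF assms(1,3)]
    by (metis mult.assoc mult.commute mult.left_neutral)
  moreover have "(z * cnj w) ^ n = (w * cnj w) ^ n"
    using assms(2,3) by (simp add: sign_roots_def power_mult_distrib)
  ultimately show ?thesis
    using False sign_root_cnj[OF assms(1,3)] by (simp add: sum_gp_strict)
qed

lemma card_sign_roots:
  assumes "n \<ge> 1"
  shows "card (sign_roots k n) = n"
  unfolding sign_roots_def using assms by (intro card_nth_roots) auto

lemma finite_sign_roots:
  assumes "n \<ge> 1"
  shows "finite (sign_roots k n)"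
  using card_sign_roots[OF assms, of k] assms card_ge_0_finite by force

text \<open>The companion orthogonality relation, summing over roots instead of exponents.
  Multiplication by the primitive root of unity \<open>\<omega>\<close> permutes the roots and
  multiplies the sum by \<open>\<omega> ^ i * cnj \<omega> ^ j\<close>, which differs from 1 if
  \<open>i \<noteq> j\<close>.\<close>

lemma sum_sign_roots:
  assumes n: "n \<ge> 1" and "i < n" "j < n"
  shows "(\<Sum>z\<in>sign_roots k n. z ^ i * cnj z ^ j) = (if i = j then of_nat n else 0)"
proof (cases "i = j")
  case True
  have "(\<Sum>z\<in>sign_roots k n. z ^ i * cnj z ^ j) = (\<Sum>z\<in>sign_roots k n. (z * cnj z) ^ i)"
    using True by (simp add: power_mult_distrib)
  also have "\<dots> = (\<Sum>z\<in>sign_roots k n. 1)"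
    using sign_root_cnj[OF n] by (intro sum.cong) auto
  finally show ?thesis using True card_sign_roots[OF n] by simp
next
  case False
  define \<omega> where "\<omega> = cis (2 * pi / real n)"
  have \<omega>n: "\<omega> ^ n = 1" using n by (simp add: \<omega>_def DeMoivre)
  have \<omega>c: "\<omega> * cnj \<omega> = 1" by (simp add: \<omega>_def cis_cnj cis_mult)
  then have \<omega>c': "cnj \<omega> * \<omega> = 1" "cnj \<omega> ^ n = 1" 
    using \<omega>n by (simp add: mult.commute, metis complex_cnj_one complex_cnj_power)
  have inj: "inj_on (\<lambda>j. cis (2 * pi * real j / real n)) {..<n}"
    using bij_betw_roots_unity[of n] n by (simp add: bij_betw_def)
  have ne: "\<omega> ^ i \<noteq> \<omega> ^ j"
    using inj_onD[OF inj, of i j] assms False by (auto simp: \<omega>_def DeMoivre mult_ac)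
  have ne': "\<omega> ^ i * cnj \<omega> ^ j \<noteq> 1"
  proof
    assume "\<omega> ^ i * cnj \<omega> ^ j = 1"
    then have "\<omega> ^ i * (cnj \<omega> * \<omega>) ^ j = \<omega> ^ j" 
      unfolding power_mult_distrib by (metis mult.assoc mult.left_neutral)
    then show False using ne \<omega>c' by simp
  qed
  have bij: "bij_betw (\<lambda>z. \<omega> * z) (sign_roots k n) (sign_roots k n)"
    by (rule bij_betwI[where g = "\<lambda>z. cnj \<omega> * z"])
       (use \<omega>n \<omega>c \<omega>c' in \<open>auto simp: sign_roots_def power_mult_distrib mult.assoc[symmetric]\<close>)
  let ?S = "\<Sum>z\<in>sign_roots k n. z ^ i * cnj z ^ j"
  have "?S = (\<Sum>z\<in>sign_roots k n. (\<omega> * z) ^ i * cnj (\<omega> * z) ^ j)"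
    using sum.reindex_bij_betw[OF bij, of "\<lambda>z. z ^ i * cnj z ^ j"] by simp
  also have "\<dots> = (\<omega> ^ i * cnj \<omega> ^ j) * ?S"
    by (simp add: sum_distrib_left power_mult_distrib mult_ac)
  finally have "?S * (\<omega> ^ i * cnj \<omega> ^ j - 1) = 0" by (simp add: algebra_simps)
  then show ?thesis using ne' False by simp
qed

section \<open>Eigenvectors of the shift and their spans\<close>

abbreviation moment_vec :: "nat \<Rightarrow> complex \<Rightarrow> complex vec" where
  "moment_vec n z \<equiv> vec n (\<lambda>i. z ^ i)"

lemma moment_vec_scalar_prod:
  assumes "n \<ge> 1" "z \<in> sign_roots k n" "w \<in> sign_roots k n"
  shows "moment_vec n z \<bullet> moment_vec n (cnj w) = (if z = w then of_nat n else 0)"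
  using sign_roots_orthogonal[OF assms]
  by (simp add: scalar_prod_def power_mult_distrib lessThan_atLeast0)

text \<open>Pairing with a conjugate vector separates the roots for every \<open>n\<close>;
  comparing the entries of index 1 would do so only for \<open>n > 1\<close>.\<close>

lemma inj_on_moment_vec:
  assumes "n \<ge> 1"
  shows "inj_on (moment_vec n) (sign_roots k n)"
proof (rule inj_onI)
  fix z w assume zw: "z \<in> sign_roots k n" "w \<in> sign_roots k n"
    and eq: "moment_vec n z = moment_vec n w"
  have "moment_vec n z \<bullet> moment_vec n (cnj w) = of_nat n"
    using moment_vec_scalar_prod[OF assms zw(2) zw(2)] by (subst eq) simp
  then show "z = w"
    using moment_vec_scalar_prod[OF assms zw] assms by (cases "z = w") simp_all
qed

lemma vec_space_lincomb_scalar_prod: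
  fixes w :: "'a :: field vec"
  assumes "S \<subseteq> carrier_vec n" "w \<in> carrier_vec n"
  shows "module.lincomb (module_vec TYPE('a) n) a S \<bullet> w = (\<Sum>v\<in>S. a v * (v \<bullet> w))"
proof -
  interpret vec_space "TYPE('a)" n .
  have "lincomb a S \<bullet> w = (\<Sum>v\<in>S. (a v \<cdot>\<^sub>v v) \<bullet> w)"
    unfolding lincomb_def using assms by (intro finsum_scalar_prod_sum) auto
  also have "\<dots> = (\<Sum>v\<in>S. a v * (v \<bullet> w))"
    using assms by (intro sum.cong) (auto simp: smult_scalar_prod_distrib[of _ n])
  finally show ?thesis .
qed

text \<open>Pairing a vanishing combination with the conjugate of one eigenvector in it leaves
  \<open>n\<close> times its coefficient.\<close>

lemma moment_vecs_lin_indpt: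
  assumes n: "n \<ge> 1" and Z: "Z \<subseteq> sign_roots k n"
  shows "\<not> module.lin_dep class_ring (module_vec TYPE(complex) n) (moment_vec n ` Z)"
proof
  interpret vec_space "TYPE(complex)" n .
  assume "lin_dep (moment_vec n ` Z)"
  then obtain S a v where S: "finite S" "S \<subseteq> moment_vec n ` Z" "lincomb a S = 0\<^sub>v n" "v \<in> S" "a v \<noteq> 0"
    unfolding lin_dep_def by blast
  then obtain w where w: "w \<in> Z" "v = moment_vec n w" by blast
  have carr: "S \<subseteq> carrier_vec n" using S by auto
  have zero: "u \<bullet> moment_vec n (cnj w) = 0" if u: "u \<in> S" "u \<noteq> v" for u
  proof -
    from u S obtain z where z: "z \<in> Z" "u = moment_vec n z" by blast
    then show ?thesis using moment_vec_scalar_prod[OF n, of z k w] u w Z by (auto simp: subset_iff)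
  qed
  have "0 = lincomb a S \<bullet> moment_vec n (cnj w)" using S by simp
  also have "\<dots> = (\<Sum>u\<in>S. a u * (u \<bullet> moment_vec n (cnj w)))"
    by (intro vec_space_lincomb_scalar_prod carr) auto
  also have "\<dots> = (\<Sum>u\<in>{v}. a u * (u \<bullet> moment_vec n (cnj w)))"
    using S zero by (intro sum.mono_neutral_right) auto
  also have "\<dots> = a v * of_nat n"
    using moment_vec_scalar_prod[OF n, of w k w] w Z by auto
  finally show False using S n by simp
qed

text \<open>Replaces combinations indexed by vectors by sums indexed by roots, the form in which the
  shift is easy to compute.\<close>

lemma mem_power_span_iff:
  assumes n: "n \<ge> 1" and Z: "Z \<subseteq> sign_roots k n"
  shows "v \<in> power_span n Z \<longleftrightarrow> (\<exists>c. v = vec n (\<lambda>i. \<Sum>z\<in>Z. c z * z ^ i))"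
proof -
  interpret vec_space "TYPE(complex)" n .
  have fin: "finite Z" using Z finite_sign_roots[OF n] finite_subset by blast
  have inj: "inj_on (moment_vec n) Z" using inj_on_moment_vec[OF n] Z inj_on_subset by blast
  have carr: "moment_vec n ` Z \<subseteq> carrier_vec n" by auto
  have lc: "lincomb a (moment_vec n ` Z) = vec n (\<lambda>i. \<Sum>z\<in>Z. a (moment_vec n z) * z ^ i)" for a
  proof (rule eq_vecI)
    fix i assume "i < dim_vec (vec n (\<lambda>i. \<Sum>z\<in>Z. a (moment_vec n z) * z ^ i))"
    then have i: "i < n" by simp
    show "lincomb a (moment_vec n ` Z) $ i = vec n (\<lambda>i. \<Sum>z\<in>Z. a (moment_vec n z) * z ^ i) $ i"
      unfolding lincomb_index[OF i carr] using i
      by (subst sum.reindex[OF inj]) simp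
  qed (use carr fin in \<open>auto simp: lincomb_dim\<close>)
  have "power_span n Z = {lincomb a (moment_vec n ` Z) |a. a \<in> (moment_vec n ` Z) \<rightarrow> UNIV}"
    unfolding power_span_def using fin carr by (subst finite_span) auto
  also have "\<dots> = range (\<lambda>a. vec n (\<lambda>i. \<Sum>z\<in>Z. a (moment_vec n z) * z ^ i))"
    by (auto simp: lc)
  finally have ps: "power_span n Z = range (\<lambda>a. vec n (\<lambda>i. \<Sum>z\<in>Z. a (moment_vec n z) * z ^ i))" .
  show ?thesis
  proof
    assume "\<exists>c. v = vec n (\<lambda>i. \<Sum>z\<in>Z. c z * z ^ i)"
    then obtain c where c: "v = vec n (\<lambda>i. \<Sum>z\<in>Z. c z * z ^ i)" by blast
    \<comment> \<open>The coefficients of \<open>lincomb\<close> are functions of vectors, so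
      \<open>c\<close> is carried over along the inverse of \<open>moment_vec n\<close>.\<close>
    have "v = vec n (\<lambda>i. \<Sum>z\<in>Z. (c \<circ> the_inv_into Z (moment_vec n)) (moment_vec n z) * z ^ i)"
      unfolding c using the_inv_into_f_f[OF inj] by (intro eq_vecI) auto
    then show "v \<in> power_span n Z" unfolding ps by blast
  qed (auto simp: ps)
qed

text \<open>The product \<open>\<bullet>\<close> is bilinear, so the Hermitian product appears as
  pairing with a conjugated vector. It vanishes on the generators, hence on their span.\<close>

lemma power_span_orthogonal:
  assumes n: "n \<ge> 1" and Z: "Z \<subseteq> sign_roots k n" and w: "w \<in> sign_roots k n - Z"
    and v: "v \<in> power_span n Z"
  shows "v \<bullet> moment_vec n (cnj w) = 0"
proof -
  interpret vec_space "TYPE(complex)" n .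
  have carr: "moment_vec n ` Z \<subseteq> carrier_vec n" by auto
  have comm: "moment_vec n (cnj w) \<bullet> u = u \<bullet> moment_vec n (cnj w)" if "u \<in> carrier_vec n" for u
    using that by (intro comm_scalar_prod[of _ n]) auto
  have "moment_vec n z \<bullet> moment_vec n (cnj w) = 0" if "z \<in> Z" for z
    using moment_vec_scalar_prod[OF n, of z k w] Z w that by auto
  then have "moment_vec n (cnj w) \<in> orthogonal_complement (moment_vec n ` Z)"
    unfolding orthogonal_complement_def by (auto simp: comm)
  then have "moment_vec n (cnj w) \<in> orthogonal_complement (power_span n Z)"
    unfolding power_span_def in_orthogonal_complement_span[OF carr] .
  moreover have "v \<in> carrier_vec n"
    using v span_closed[OF carr] unfolding power_span_def by auto
  ultimately show ?thesis
    using v comm[of v] unfolding orthogonal_complement_def by auto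
qed

text \<open>This recovers \<open>Z\<close> from its span: the eigenvector of an omitted root, if it
  lay in the span, would be orthogonal to itself, while its squared norm is
  \<open>n\<close>.\<close>

lemma moment_vec_mem_power_span_iff:
  assumes n: "n \<ge> 1" and Z: "Z \<subseteq> sign_roots k n" and w: "w \<in> sign_roots k n"
  shows "moment_vec n w \<in> power_span n Z \<longleftrightarrow> w \<in> Z"
proof
  interpret vec_space "TYPE(complex)" n .
  have "moment_vec n ` Z \<subseteq> carrier_vec n" by auto
  then show "w \<in> Z \<Longrightarrow> moment_vec n w \<in> power_span n Z"
    unfolding power_span_def using in_own_span by blast
  show "w \<in> Z" if "moment_vec n w \<in> power_span n Z"
    using power_span_orthogonal[OF n Z _ that, of w] moment_vec_scalar_prod[OF n w w] n w
    by (cases "w \<in> Z") auto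
qed

lemma dim_power_span:
  assumes n: "n \<ge> 1" and Z: "Z \<subseteq> sign_roots k n"
  shows "vectorspace.dim class_ring ((module_vec TYPE(complex) n)\<lparr>carrier := power_span n Z\<rparr>) = card Z"
proof -
  interpret vec_space "TYPE(complex)" n .
  have fin: "finite Z" using Z finite_sign_roots[OF n] finite_subset by blast
  have inj: "inj_on (moment_vec n) Z" using inj_on_moment_vec[OF n] Z inj_on_subset by blast
  let ?S = "moment_vec n ` Z"
  have carr: "?S \<subseteq> carrier_vec n" by auto
  have sub: "subspace class_ring (span ?S) V" using span_is_subspace carr by simp
  interpret W: vectorspace class_ring "vs (span ?S)" by (rule subspace_is_vs[OF sub])
  have own: "?S \<subseteq> span ?S" using in_own_span[OF carr] .
  have subm: "submodule class_ring (span ?S) V" using span_is_submodule carr by simp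
  have "W.basis ?S" 
    using span_li_not_depend[OF own subm] moment_vecs_lin_indpt[OF n Z] own
    unfolding W.basis_def by (auto simp: carrier_vs_is_self)
  then have "W.dim = card ?S" using fin by (intro W.dim_basis) auto
  then show ?thesis using card_image[OF inj] by (simp add: power_span_def)
qed

lemma power_span_mem_Gr:
  assumes n: "n \<ge> 1" and Z: "Z \<subseteq> sign_roots k n"
  shows "power_span n Z \<in> Gr (card Z) n"
proof -
  interpret vec_space "TYPE(complex)" n .
  have "moment_vec n ` Z \<subseteq> carrier_vec n" by auto
  then have "subspace class_ring (power_span n Z) V"
    unfolding power_span_def using span_is_subspace by simp
  then show ?thesis using dim_power_span[OF assms] by (simp add: Gr_def)
qed

section \<open>Action of the shift on spans of eigenvectors\<close>

lemma cyclic_shift_power_sum: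
  assumes n: "n \<ge> 1" and Z: "Z \<subseteq> sign_roots k n"
  shows "cyclic_shift k n (vec n (\<lambda>i. \<Sum>z\<in>Z. c z * z ^ i)) = vec n (\<lambda>i. \<Sum>z\<in>Z. (c z * z) * z ^ i)"
proof (rule eq_vecI)
  fix i assume "i < dim_vec (vec n (\<lambda>i. \<Sum>z\<in>Z. (c z * z) * z ^ i))"
  then have i: "i < n" by simp
  show "cyclic_shift k n (vec n (\<lambda>i. \<Sum>z\<in>Z. c z * z ^ i)) $ i = vec n (\<lambda>i. \<Sum>z\<in>Z. (c z * z) * z ^ i) $ i"
  proof (cases "i + 1 < n")
    \<comment> \<open>In the last coordinate the shift inserts the sign times coordinate 0, and the
      sign equals \<open>z ^ n = z * z ^ i\<close>.\<close>
    case False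
    then have "n = Suc i" using i by simp
    then have "z * z ^ i = (-1) powi (int k - 1)" if "z \<in> Z" for z
      using that Z by (auto simp: sign_roots_def)
    then have "(\<Sum>z\<in>Z. (c z * z) * z ^ i) = (\<Sum>z\<in>Z. c z * (-1) powi (int k - 1))"
      by (intro sum.cong) (simp_all only: mult.assoc)
    also have "\<dots> = (-1) powi (int k - 1) * (\<Sum>z\<in>Z. c z)"
      by (subst sum_distrib_left) (simp only: mult.commute)
    finally show ?thesis using False i n
      by (simp add: cyclic_shift_def)
  qed (use i in \<open>simp add: cyclic_shift_def mult_ac\<close>)
qed (simp add: cyclic_shift_def)

lemma cyclic_shift_image_power_span:
  assumes n: "n \<ge> 1" and Z: "Z \<subseteq> sign_roots k n"
  shows "cyclic_shift k n ` power_span n Z = power_span n Z"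
proof (intro equalityI subsetI)
  fix v assume "v \<in> cyclic_shift k n ` power_span n Z"
  then obtain u where "u \<in> power_span n Z" "v = cyclic_shift k n u" by blast
  then obtain c where "v = cyclic_shift k n (vec n (\<lambda>i. \<Sum>z\<in>Z. c z * z ^ i))"
    unfolding mem_power_span_iff[OF assms] by blast
  then show "v \<in> power_span n Z"
    unfolding mem_power_span_iff[OF assms] cyclic_shift_power_sum[OF assms]
    by (rule exI[where x = "\<lambda>z. c z * z"])
next
  fix v assume "v \<in> power_span n Z"
  then obtain c where c: "v = vec n (\<lambda>i. \<Sum>z\<in>Z. c z * z ^ i)"
    unfolding mem_power_span_iff[OF assms] by blast
  \<comment> \<open>The preimage divides each coefficient by its eigenvalue \<open>z\<close>, whose
    inverse is \<open>cnj z\<close>.\<close>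
  have "(\<Sum>z\<in>Z. c z * z ^ i) = (\<Sum>z\<in>Z. (c z * cnj z * z) * z ^ i)" for i
  proof (intro sum.cong refl)
    fix z assume "z \<in> Z"
    then have "z * cnj z = 1" using sign_root_cnj[OF n] Z by blast
    moreover have "c z * cnj z * z = c z * (z * cnj z)" by (simp only: ac_simps)
    ultimately show "c z * z ^ i = (c z * cnj z * z) * z ^ i" by simp
  qed
  then have "v = cyclic_shift k n (vec n (\<lambda>i. \<Sum>z\<in>Z. (c z * cnj z) * z ^ i))"
    unfolding cyclic_shift_power_sum[OF assms] c by simp
  then show "v \<in> cyclic_shift k n ` power_span n Z"
    by (rule image_eqI) (unfold mem_power_span_iff[OF assms], rule exI, rule refl)
qed

section \<open>Invariant subspaces\<close>

text \<open>A twisted discrete Fourier inversion: the coefficients are Hermitian products with the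
  eigenvectors, divided by their squared norm \<open>n\<close>.\<close>

lemma vec_eq_power_sum:
  assumes n: "n \<ge> 1" and v: "v \<in> carrier_vec n"
  shows "v = vec n (\<lambda>i. \<Sum>z\<in>sign_roots k n. ((\<Sum>j<n. v $ j * cnj z ^ j) / of_nat n) * z ^ i)"
proof (rule eq_vecI)
  fix i assume "i < dim_vec (vec n (\<lambda>i. \<Sum>z\<in>sign_roots k n. ((\<Sum>j<n. v $ j * cnj z ^ j) / of_nat n) * z ^ i))"
  then have i: "i < n" by simp
  have "(\<Sum>z\<in>sign_roots k n. ((\<Sum>j<n. v $ j * cnj z ^ j) / of_nat n) * z ^ i) =
        (\<Sum>z\<in>sign_roots k n. \<Sum>j<n. v $ j / of_nat n * (z ^ i * cnj z ^ j))"
    by (simp add: sum_divide_distrib sum_distrib_left sum_distrib_right mult_ac)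
  also have "\<dots> = (\<Sum>j<n. v $ j / of_nat n * (\<Sum>z\<in>sign_roots k n. z ^ i * cnj z ^ j))"
    by (subst sum.swap) (simp add: sum_distrib_left)
  also have "\<dots> = (\<Sum>j<n. if i = j then v $ j else 0)"
    using sum_sign_roots[OF n i] n by (intro sum.cong) auto
  also have "\<dots> = v $ i" using i by simp
  finally show "v $ i = vec n (\<lambda>i. \<Sum>z\<in>sign_roots k n. ((\<Sum>j<n. v $ j * cnj z ^ j) / of_nat n) * z ^ i) $ i"
    using i by simp
qed (use v in simp)

lemma funpow_cyclic_shift_power_sum:
  assumes "n \<ge> 1" "Z \<subseteq> sign_roots k n"
  shows "(cyclic_shift k n ^^ m) (vec n (\<lambda>i. \<Sum>z\<in>Z. c z * z ^ i)) =
    vec n (\<lambda>i. \<Sum>z\<in>Z. (c z * z ^ m) * z ^ i)"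
proof (induction m)
  case (Suc m)
  show ?case
    unfolding funpow.simps o_apply Suc cyclic_shift_power_sum[OF assms]
    by (simp only: power_Suc2 mult.assoc)
qed simp

lemma subspace_closed:
  assumes "VectorSpace.subspace class_ring V (module_vec TYPE(complex) n)"
  shows "V \<subseteq> carrier_vec n" "0\<^sub>v n \<in> V" "u \<in> V \<Longrightarrow> v \<in> V \<Longrightarrow> u + v \<in> V" "v \<in> V \<Longrightarrow> c \<cdot>\<^sub>v v \<in> V"
proof -
  interpret vec_space "TYPE(complex)" n .
  have sub: "submodule class_ring V (module_vec TYPE(complex) n)"
    using assms by (simp add: subspace_def)
  show "V \<subseteq> carrier_vec n" "0\<^sub>v n \<in> V" "u \<in> V \<Longrightarrow> v \<in> V \<Longrightarrow> u + v \<in> V" "v \<in> V \<Longrightarrow> c \<cdot>\<^sub>v v \<in> V"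
    using sub unfolding submodule_def by (auto simp: module_vec_simps class_ring_simps)
qed

lemma subspace_sum_closed:
  assumes V: "VectorSpace.subspace class_ring V (module_vec TYPE(complex) n)"
    and "finite I" "\<And>i. i \<in> I \<Longrightarrow> f i \<in> V"
  shows "vec n (\<lambda>j. \<Sum>i\<in>I. c i * f i $ j) \<in> V"
  using assms(2,3)
proof (induction I)
  case empty
  have "vec n (\<lambda>j. \<Sum>i\<in>{}. c i * f i $ j) = 0\<^sub>v n" by auto
  then show ?case using subspace_closed(2)[OF V] by metis
next
  case (insert x I)
  have "f x \<in> carrier_vec n" using insert.prems subspace_closed(1)[OF V] by auto
  then have "vec n (\<lambda>j. \<Sum>i\<in>insert x I. c i * f i $ j) =
    c x \<cdot>\<^sub>v f x + vec n (\<lambda>j. \<Sum>i\<in>I. c i * f i $ j)"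
    using insert.hyps by auto
  then show ?case using insert subspace_closed(3,4)[OF V] by auto
qed

text \<open>The spectral projections of the shift are polynomials in the shift, so they preserve invariant
  subspaces.\<close>

lemma invariant_subspace_eq_power_span:
  assumes n: "n \<ge> 1"
    and V: "VectorSpace.subspace class_ring V (module_vec TYPE(complex) n)"
    and inv: "cyclic_shift k n ` V \<subseteq> V"
  shows "V = power_span n {z \<in> sign_roots k n. moment_vec n z \<in> V}"
proof -
  define R where "R = sign_roots k n"
  have RR: "R \<subseteq> sign_roots k n" by (simp add: R_def)
  have finR: "finite R" using finite_sign_roots[OF n] by (simp add: R_def)
  define Z where "Z = {z \<in> R. moment_vec n z \<in> V}"
  have ZR: "Z \<subseteq> sign_roots k n" by (auto simp: Z_def R_def)
  have "V \<subseteq> power_span n Z"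
  proof
    fix v assume v: "v \<in> V"
    define c where "c z = (\<Sum>j<n. v $ j * cnj z ^ j) / of_nat n" for z
    have ve: "v = vec n (\<lambda>i. \<Sum>z\<in>R. c z * z ^ i)"
      using vec_eq_power_sum[OF n, of v k] v subspace_closed(1)[OF V] by (auto simp: c_def R_def)
    have pow: "(cyclic_shift k n ^^ m) v \<in> V" for m
      by (induction m) (use v inv in auto)
    have zero: "c w = 0" if w: "w \<in> R - Z" for w
    proof (rule ccontr)
      assume cw: "c w \<noteq> 0"
      \<comment> \<open>Weighting the \<open>m\<close>-th shift by \<open>cnj w ^ m\<close> cancels
        the eigenvalue at \<open>w\<close>, and geometric sums kill every other eigenvector. What
        remains is \<open>n\<close> times the component of \<open>v\<close> along the eigenvector of
        \<open>w\<close>.\<close>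
      have "vec n (\<lambda>j. \<Sum>m\<in>{..<n}. cnj w ^ m * (cyclic_shift k n ^^ m) v $ j) \<in> V"
        by (intro subspace_sum_closed V pow) auto
      also have "vec n (\<lambda>j. \<Sum>m\<in>{..<n}. cnj w ^ m * (cyclic_shift k n ^^ m) v $ j) =
        (c w * of_nat n) \<cdot>\<^sub>v moment_vec n w"
      proof (rule eq_vecI)
        fix i assume "i < dim_vec ((c w * of_nat n) \<cdot>\<^sub>v moment_vec n w)"
        then have i: "i < n" by simp
        have "(\<Sum>m\<in>{..<n}. cnj w ^ m * (cyclic_shift k n ^^ m) v $ i) =
          (\<Sum>m<n. \<Sum>z\<in>R. c z * z ^ i * (z * cnj w) ^ m)"
          unfolding ve funpow_cyclic_shift_power_sum[OF n RR] using i
          by (simp add: sum_distrib_left power_mult_distrib mult_ac)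
        also have "\<dots> = (\<Sum>z\<in>R. c z * z ^ i * (\<Sum>m<n. (z * cnj w) ^ m))"
          by (subst sum.swap) (simp add: sum_distrib_left)
        also have "\<dots> = (\<Sum>z\<in>R. if z = w then c z * z ^ i * of_nat n else 0)"
          using sign_roots_orthogonal[OF n, of _ k w] w by (intro sum.cong) (auto simp: R_def)
        also have "\<dots> = c w * w ^ i * of_nat n"
          using w finR by simp
        finally show "vec n (\<lambda>j. \<Sum>m\<in>{..<n}. cnj w ^ m * (cyclic_shift k n ^^ m) v $ j) $ i =
          ((c w * of_nat n) \<cdot>\<^sub>v moment_vec n w) $ i"
          using i by simp
      qed simp
      finally have "inverse (c w * of_nat n) \<cdot>\<^sub>v ((c w * of_nat n) \<cdot>\<^sub>v moment_vec n w) \<in> V"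
        by (rule subspace_closed(4)[OF V])
      then have "moment_vec n w \<in> V"
        using cw n by (simp add: smult_smult_assoc del: inverse_mult_distrib)
      then show False using w by (simp add: Z_def)
    qed
    have "(\<Sum>z\<in>R. c z * z ^ i) = (\<Sum>z\<in>Z. c z * z ^ i)" for i
      using finR zero by (intro sum.mono_neutral_right) (auto simp: Z_def)
    then show "v \<in> power_span n Z"
      unfolding mem_power_span_iff[OF n ZR] ve by auto
  qed
  moreover have "power_span n Z \<subseteq> V"
  proof
    fix v assume "v \<in> power_span n Z"
    then obtain c where c: "v = vec n (\<lambda>i. \<Sum>z\<in>Z. c z * z ^ i)"
      unfolding mem_power_span_iff[OF n ZR] by blast
    have "v = vec n (\<lambda>i. \<Sum>z\<in>Z. c z * moment_vec n z $ i)"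
      unfolding c by (rule eq_vecI) auto
    also have "\<dots> \<in> V"
      using finR by (intro subspace_sum_closed V) (auto simp: Z_def)
    finally show "v \<in> V" .
  qed
  ultimately show ?thesis by (auto simp: Z_def R_def)
qed

lemma shift_fixed_points_eq:
  assumes n: "n \<ge> 1"
  shows "shift_fixed_points k n = {power_span n Z | Z. Z \<subseteq> sign_roots k n \<and> card Z = k}"
proof (intro equalityI subsetI)
  fix V assume V: "V \<in> shift_fixed_points k n"
  define Z where "Z = {z \<in> sign_roots k n. moment_vec n z \<in> V}"
  have Z: "Z \<subseteq> sign_roots k n" by (auto simp: Z_def)
  have "V = power_span n Z"
    unfolding Z_def using V n
    by (intro invariant_subspace_eq_power_span) (auto simp: shift_fixed_points_def Gr_def)
  moreover from this have "card Z = k"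
    using V dim_power_span[OF n Z] by (simp add: shift_fixed_points_def Gr_def)
  ultimately show "V \<in> {power_span n Z | Z. Z \<subseteq> sign_roots k n \<and> card Z = k}"
    using Z by blast
next
  fix V assume "V \<in> {power_span n Z | Z. Z \<subseteq> sign_roots k n \<and> card Z = k}"
  then show "V \<in> shift_fixed_points k n"
    using power_span_mem_Gr[OF n] cyclic_shift_image_power_span[OF n]
    unfolding shift_fixed_points_def by blast
qed

lemma inj_on_power_span:
  assumes n: "n \<ge> 1"
  shows "inj_on (power_span n) {Z. Z \<subseteq> sign_roots k n \<and> card Z = k}"
proof (rule inj_onI)
  fix Y Z assume Y: "Y \<in> {Z. Z \<subseteq> sign_roots k n \<and> card Z = k}"
    and Z: "Z \<in> {Z. Z \<subseteq> sign_roots k n \<and> card Z = k}" and eq: "power_span n Y = power_span n Z"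
  have "w \<in> Y \<longleftrightarrow> w \<in> Z" if "w \<in> sign_roots k n" for w
    using moment_vec_mem_power_span_iff[OF n _ that, of Y] moment_vec_mem_power_span_iff[OF n _ that, of Z]
      Y Z eq by simp
  then show "Y = Z" using Y Z by blast
qed

lemma card_shift_fixed_points:
  assumes n: "n \<ge> 1"
  shows "card (shift_fixed_points k n) = n choose k"
proof -
  have "shift_fixed_points k n = power_span n ` {Z. Z \<subseteq> sign_roots k n \<and> card Z = k}"
    using shift_fixed_points_eq[OF n] by auto
  then show ?thesis
    using card_image[OF inj_on_power_span[OF n]] n_subsets[OF finite_sign_roots[OF n]]
      card_sign_roots[OF n] by simp
qed

section \<open>Determinants\<close>

text \<open>The Newton basis \<open>\<Prod>m<i. (x - x m)\<close> is unitriangular over the monomials and turns the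
  Vandermonde matrix into a triangular one.\<close>

lemma det_vandermonde:
  fixes x :: "nat \<Rightarrow> 'a :: idom"
  shows "det (mat k k (\<lambda>(i, j). x j ^ i)) = (\<Prod>j<k. \<Prod>m<j. x j - x m)"
proof -
  define p where "p i = (\<Prod>m<i. [:- x m, 1:])" for i
  define L where "L = mat k k (\<lambda>(i, m). coeff (p i) m)"
  define X where "X = mat k k (\<lambda>(i, j). x j ^ i)"
  define N where "N = mat k k (\<lambda>(i, j). \<Prod>m<i. x j - x m)"
  have deg: "degree (p i) = i" for i
    unfolding p_def by (simp add: degree_prod_sum_eq)
  have monic: "lead_coeff (p i) = 1" for i
    unfolding p_def by (subst lead_coeff_prod) simp
  \<comment> \<open>Row \<open>i\<close> of \<open>L\<close> holds the coefficients of the Newton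
    polynomial \<open>p i\<close>, so its product with column \<open>j\<close> of \<open>X\<close>
    is the value of \<open>p i\<close> at \<open>x j\<close>.\<close>
  have LX: "L * X = N"
  proof (rule eq_matI)
    fix i j assume "i < dim_row N" "j < dim_col N"
    then have ij: "i < k" "j < k" by (simp_all add: N_def)
    have "(L * X) $$ (i, j) = (\<Sum>m<k. coeff (p i) m * x j ^ m)"
      using ij by (simp add: L_def X_def scalar_prod_def lessThan_atLeast0)
    also have "\<dots> = (\<Sum>m\<le>i. coeff (p i) m * x j ^ m)"
      using ij deg[of i] by (intro sum.mono_neutral_right) (auto intro!: coeff_eq_0)
    also have "\<dots> = poly (p i) (x j)"
      using deg[of i] by (simp add: poly_altdef)
    also have "\<dots> = N $$ (i, j)"
      using ij by (simp add: N_def p_def poly_prod)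
    finally show "(L * X) $$ (i, j) = N $$ (i, j)" .
  qed (auto simp: L_def X_def N_def)
  have "det L = prod_list (diag_mat L)"
    by (rule det_lower_triangular[of k]) (auto simp: L_def deg coeff_eq_0)
  also have "\<dots> = (\<Prod>i<k. coeff (p i) i)"
    by (simp add: prod_list_diag_prod L_def lessThan_atLeast0)
  also have "\<dots> = 1"
    using monic deg by simp
  finally have "det L = 1" .
  \<comment> \<open>For \<open>j < i\<close> the factor with \<open>m = j\<close> is zero.\<close>
  moreover have "det N = prod_list (diag_mat N)"
    by (rule det_upper_triangular[of _ k]) (auto simp: N_def upper_triangular_def)
  then have "det N = (\<Prod>j<k. \<Prod>m<j. x j - x m)"
    by (simp add: prod_list_diag_prod N_def lessThan_atLeast0)
  moreover have "det (L * X) = det L * det X"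
    by (rule det_mult[of _ k]) (auto simp: L_def X_def)
  ultimately show ?thesis by (simp add: LX flip: X_def)
qed

lemma det_scale_cols:
  fixes A :: "'a :: comm_ring_1 mat"
  assumes "A \<in> carrier_mat k k"
  shows "det (mat k k (\<lambda>(i, j). c j * A $$ (i, j))) = (\<Prod>j<k. c j) * det A"
proof -
  have "(\<Prod>j<k. mat k k (\<lambda>(i, j). c j * A $$ (i, j)) $$ (p j, j)) = (\<Prod>j<k. c j) * (\<Prod>j<k. A $$ (p j, j))"
    if "p permutes {0..<k}" for p
    unfolding prod.distrib[symmetric] using permutes_in_image[OF that] by (intro prod.cong) auto
  then show ?thesis
    by (simp add: det_col[of _ k] assms sum_distrib_left mult_ac)
qed

text \<open>The Cauchy--Binet formula with both determinants summed over all column maps instead of over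
  increasing ones, so that every subset is counted \<open>k!\<close> times.\<close>

lemma det_mult_sum_PiE:
  fixes A B :: "'a :: comm_ring_1 mat"
  assumes A: "A \<in> carrier_mat k n" and B: "B \<in> carrier_mat n k"
  shows "(\<Sum>f\<in>{..<k} \<rightarrow>\<^sub>E {..<n}. det (mat k k (\<lambda>(i, j). A $$ (i, f j))) * det (mat k k (\<lambda>(i, j). B $$ (f i, j))))
    = of_nat (fact k) * det (A * B)"
proof -
  let ?P = "{p. p permutes {0..<k}}"
  define C where "C = A * B"
  have C: "C \<in> carrier_mat k k" using A B by (simp add: C_def)
  have dA: "det (mat k k (\<lambda>(i, j). A $$ (i, f j))) = (\<Sum>p\<in>?P. signof p * (\<Prod>j<k. A $$ (p j, f j)))" for f
  proof -
    have "(\<Prod>j<k. mat k k (\<lambda>(i, j). A $$ (i, f j)) $$ (p j, j)) = (\<Prod>j<k. A $$ (p j, f j))"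
      if "p permutes {0..<k}" for p
      using permutes_in_image[OF that] by (intro prod.cong) auto
    then show ?thesis by (simp add: det_col[of _ k])
  qed
  have dB: "det (mat k k (\<lambda>(i, j). B $$ (f i, j))) = (\<Sum>q\<in>?P. signof q * (\<Prod>j<k. B $$ (f j, q j)))" for f
  proof -
    have "(\<Prod>i = 0..<k. mat k k (\<lambda>(i, j). B $$ (f i, j)) $$ (i, q i)) = (\<Prod>j<k. B $$ (f j, q j))"
      if "q permutes {0..<k}" for q
      unfolding lessThan_atLeast0 using permutes_in_image[OF that] by (intro prod.cong) auto
    then show ?thesis by (simp add: det_def'[of _ k])
  qed
  have CE: "(\<Sum>m<n. A $$ (p j, m) * B $$ (m, q j)) = C $$ (p j, q j)"
    if "p \<in> ?P" "q \<in> ?P" "j < k" for p q j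
    using A B that permutes_in_image[of p "{0..<k}" j] permutes_in_image[of q "{0..<k}" j]
    by (simp add: C_def scalar_prod_def lessThan_atLeast0)
  let ?F = "{..<k} \<rightarrow>\<^sub>E {..<n}"
  \<comment> \<open>The Leibniz expansion by columns for \<open>A\<close> and by rows for
    \<open>B\<close> lets both products run over the same \<open>f j\<close>.\<close>
  have "(\<Sum>f\<in>?F. det (mat k k (\<lambda>(i, j). A $$ (i, f j))) * det (mat k k (\<lambda>(i, j). B $$ (f i, j)))) =
    (\<Sum>f\<in>?F. \<Sum>p\<in>?P. \<Sum>q\<in>?P. signof p * signof q * (\<Prod>j<k. A $$ (p j, f j) * B $$ (f j, q j)))"
    unfolding dA dB sum_product by (simp add: prod.distrib mult_ac)
  also have "\<dots> = (\<Sum>p\<in>?P. \<Sum>q\<in>?P. signof p * signof q * (\<Sum>f\<in>?F. \<Prod>j<k. A $$ (p j, f j) * B $$ (f j, q j)))"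
    by (subst sum.swap, rule sum.cong[OF refl], subst sum.swap) (simp add: sum_distrib_left)
  \<comment> \<open>Because \<open>f\<close> ranges over all maps, the distributive law turns the
    sum of products into a product of sums, which are entries of \<open>A * B\<close>.\<close>
  also have "\<dots> = (\<Sum>p\<in>?P. \<Sum>q\<in>?P. signof p * signof q * (\<Prod>j<k. \<Sum>m<n. A $$ (p j, m) * B $$ (m, q j)))"
    by (simp add: prod_sum_PiE)
  also have "\<dots> = (\<Sum>p\<in>?P. \<Sum>q\<in>?P. signof p * (signof q * (\<Prod>j<k. C $$ (p j, q j))))"
    using CE by (intro sum.cong) (auto simp: mult.assoc)
  \<comment> \<open>For fixed \<open>p\<close> the sum over \<open>q\<close> is the determinant of
    \<open>C\<close> with rows permuted by \<open>p\<close>. Its sign cancels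
    \<open>signof p\<close>, so each of the \<open>k!\<close> permutations contributes
    \<open>det C\<close>.\<close>
  also have "\<dots> = (\<Sum>p\<in>?P. signof p * det (mat k k (\<lambda>(i, j). C $$ (p i, j))))"
  proof (rule sum.cong[OF refl])
    fix p assume p: "p \<in> ?P"
    have "(\<Prod>i = 0..<k. mat k k (\<lambda>(i, j). C $$ (p i, j)) $$ (i, q i)) = (\<Prod>j<k. C $$ (p j, q j))"
      if "q permutes {0..<k}" for q
      unfolding lessThan_atLeast0 using permutes_in_image[OF that] by (intro prod.cong) auto
    then show "(\<Sum>q\<in>?P. signof p * (signof q * (\<Prod>j<k. C $$ (p j, q j)))) =
      signof p * det (mat k k (\<lambda>(i, j). C $$ (p i, j)))"
      by (simp add: det_def'[of _ k] sum_distrib_left)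
  qed
  also have "\<dots> = (\<Sum>p\<in>?P. det C)"
    by (intro sum.cong) (auto simp: det_permute_rows[OF C] sign_def)
  also have "\<dots> = of_nat (fact k) * det C"
    by (simp add: card_permutations)
  finally show ?thesis by (simp add: C_def)
qed

section \<open>Minors of column sequences as signed Pluecker coordinates\<close>

lemma det_permute_cols:
  fixes A :: "'a :: comm_ring_1 mat"
  assumes A: "A \<in> carrier_mat k k" and p: "p permutes {0..<k}"
  shows "det (mat k k (\<lambda>(i, j). A $$ (i, p j))) = signof p * det A"
proof -
  have "mat k k (\<lambda>(i, j). A $$ (i, p j)) = transpose_mat (mat k k (\<lambda>(i, j). A\<^sup>T $$ (p i, j)))"
    using A permutes_in_image[OF p] by (intro eq_matI) auto
  then have "det (mat k k (\<lambda>(i, j). A $$ (i, p j))) = det (mat k k (\<lambda>(i, j). A\<^sup>T $$ (p i, j)))"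
    by (simp add: det_transpose[of _ k])
  also have "\<dots> = signof p * det (A\<^sup>T)"
    using A p by (intro det_permute_rows) auto
  finally show ?thesis using A by (simp add: det_transpose)
qed

lemma submatrix_UNIV_cols:
  assumes "A \<in> carrier_mat k n" "I \<subseteq> {..<n}"
  shows "submatrix A UNIV I = mat k (card I) (\<lambda>(i, j). A $$ (i, pick I j))"
proof -
  have "{j. j < n \<and> j \<in> I} = I" using assms(2) by auto
  then show ?thesis using assms(1) by (simp add: submatrix_def pick_UNIV)
qed

lemma bij_betw_pick:
  assumes "finite I"
  shows "bij_betw (pick I) {..<card I} I"
proof -
  have "inj_on (pick I) {..<card I}"
    using pick_mono_le by (intro linorder_inj_onI') (metis lessThan_iff less_irrefl)
  moreover have "pick I ` {..<card I} \<subseteq> I"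
    using pick_in_set_le by auto
  ultimately show ?thesis
    using assms card_image[of "pick I" "{..<card I}"] card_subset_eq[of I "pick I ` {..<card I}"]
    by (simp add: bij_betw_def)
qed

text \<open>The permutation sorts the column sequence \<open>f\<close> and does not depend on the
  matrix. Hence one sign serves both factors of a Cauchy--Binet summand and cancels there.\<close>

lemma det_cols_eq_signof_plucker:
  assumes "f \<in> {..<k} \<rightarrow> {..<n}" "inj_on f {..<k}"
  shows "\<exists>p. p permutes {0..<k} \<and> (\<forall>A\<in>carrier_mat k n.
    det (mat k k (\<lambda>(i, j). A $$ (i, f j))) = signof p * plucker A (f ` {..<k}))"
proof -
  define I where "I = f ` {..<k}"
  have fin: "finite I" and card: "card I = k" and I: "I \<subseteq> {..<n}"
    using assms by (auto simp: I_def card_image)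
  have bij: "bij_betw (pick I) {..<k} I" using bij_betw_pick[OF fin] card by simp
  \<comment> \<open>The position of \<open>f j\<close> in the increasing enumeration of
    \<open>I\<close>, extended by the identity as \<open>permutes\<close> demands.\<close>
  define p where "p j = (if j < k then the_inv_into {..<k} (pick I) (f j) else j)" for j
  have pick: "pick I (p j) = f j" if "j < k" for j
    using that bij by (simp add: p_def f_the_inv_into_f_bij_betw I_def)
  have "bij_betw f {..<k} I" using assms by (simp add: I_def bij_betw_def)
  then have "bij_betw (the_inv_into {..<k} (pick I) \<circ> f) {..<k} {..<k}"
    using bij_betw_the_inv_into[OF bij] bij_betw_trans by blast
  then have "bij_betw p {..<k} {..<k}"
    by (rule bij_betw_cong[THEN iffD1, rotated]) (simp add: p_def)
  then have perm: "p permutes {0..<k}"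
    unfolding lessThan_atLeast0 by (intro bij_imp_permutes) (auto simp: p_def)
  show ?thesis
  proof (intro exI conjI ballI)
    show "p permutes {0..<k}" by (rule perm)
    fix A :: "complex mat" assume A: "A \<in> carrier_mat k n"
    define M where "M = mat k k (\<lambda>(i, j). A $$ (i, pick I j))"
    have "mat k k (\<lambda>(i, j). A $$ (i, f j)) = mat k k (\<lambda>(i, j). M $$ (i, p j))"
      using pick permutes_in_image[OF perm] by (intro eq_matI) (auto simp: M_def)
    then have "det (mat k k (\<lambda>(i, j). A $$ (i, f j))) = signof p * det M"
      using det_permute_cols[OF _ perm, of M] by (simp add: M_def)
    also have "M = submatrix A UNIV I"
      using submatrix_UNIV_cols[OF A I] card by (simp add: M_def)
    finally show "det (mat k k (\<lambda>(i, j). A $$ (i, f j))) = signof p * plucker A (f ` {..<k})"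
      by (simp add: plucker_def I_def)
  qed
qed

section \<open>The roots closest to 1\<close>

text \<open>The angles descend in steps of \<open>2 * pi / n\<close>, and the first \<open>k\<close>
  of them are symmetric about 0.\<close>

definition shift_root :: "nat \<Rightarrow> nat \<Rightarrow> nat \<Rightarrow> complex" where
  "shift_root k n j = cis ((real k - 1 - 2 * real j) * pi / real n)"

lemma shift_root_mem:
  assumes n: "n \<ge> 1"
  shows "shift_root k n j \<in> sign_roots k n"
proof -
  \<comment> \<open>Subtracting the even number \<open>2 * int j\<close> does not change the power
    of -1. The exponent is an integer because it may be negative.\<close>
  have "shift_root k n j ^ n = cis (of_int (int k - 1 - 2 * int j) * pi)"
    using n by (simp add: shift_root_def DeMoivre)
  also have "\<dots> = exp (of_int (int k - 1 - 2 * int j) * (\<i> * of_real pi))"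
    by (simp add: cis_conv_exp mult_ac)
  also have "\<dots> = (-1) powi (int k - 1 - 2 * int j)"
    by (simp add: exp_power_int flip: exp_pi_i')
  also have "\<dots> = (-1) powi (int k - 1)"
    by (simp add: power_int_diff power_int_mult)
  finally show ?thesis by (simp add: sign_roots_def)
qed

text \<open>The points are a nonzero constant divided by the \<open>n\<close>th roots of
  unity.\<close>

lemma inj_on_shift_root:
  assumes n: "n \<ge> 1"
  shows "inj_on (shift_root k n) {..<n}"
proof -
  have "inj_on (\<lambda>j. cis (2 * pi * real j / real n)) {..<n}"
    using bij_betw_roots_unity[of n] n by (simp add: bij_betw_def)
  moreover have "shift_root k n j = cis ((real k - 1) * pi / real n) / cis (2 * pi * real j / real n)" for j
    by (simp add: shift_root_def cis_divide diff_divide_distrib add_divide_distrib algebra_simps)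
  ultimately show ?thesis
    by (simp add: inj_on_def)
qed

lemma sign_roots_eq_image:
  assumes n: "n \<ge> 1"
  shows "sign_roots k n = shift_root k n ` {..<n}"
  using card_subset_eq[OF finite_sign_roots[OF n], of "shift_root k n ` {..<n}" k]
    shift_root_mem[OF n] card_image[OF inj_on_shift_root[OF n]] card_sign_roots[OF n]
  by (metis card_lessThan image_subsetI)

lemma card_shift_root_image:
  assumes "n \<ge> 1" "k \<le> n"
  shows "card (shift_root k n ` {..<k}) = k"
  using card_image[OF inj_on_subset[OF inj_on_shift_root[OF assms(1)]], of "{..<k}" k] assms by auto

text \<open>On the unit circle the squared distance to 1 is \<open>2 - 2 * Re z\<close>.\<close>

lemma dist_1_less_iff:
  fixes z w :: complex
  assumes "norm z = 1" "norm w = 1"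
  shows "dist z 1 < dist w 1 \<longleftrightarrow> Re w < Re z"
proof -
  have "(dist z 1)\<^sup>2 = 2 - 2 * Re z" if "norm z = 1" for z :: complex
  proof -
    have "(Re z)\<^sup>2 + (Im z)\<^sup>2 = 1" using that by (simp add: cmod_def)
    then show ?thesis unfolding dist_norm cmod_power2 by (simp add: power2_eq_square algebra_simps)
  qed
  then show ?thesis
    using assms power_mono_iff[of "dist w 1" "dist z 1" 2] by (simp add: not_le[symmetric])
qed

text \<open>The inner root has absolute angle \<open>a\<close>, the outer one angle
  \<open>-b\<close>, where \<open>b\<close> may exceed \<open>pi\<close>. Both \<open>a < b\<close>
  and \<open>a < 2 * pi - b\<close> hold, so the cosine, decreasing on the interval from 0 to
  \<open>pi\<close>, compares \<open>a\<close> with \<open>b\<close> or with its reflection.\<close>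

lemma Re_shift_root_less:
  assumes "j < k" "k \<le> l" "l < n"
  shows "Re (shift_root k n l) < Re (shift_root k n j)"
proof -
  define a where "a = \<bar>real k - 1 - 2 * real j\<bar> * pi / real n"
  define b where "b = (2 * real l + 1 - real k) * pi / real n"
  have Rj: "Re (shift_root k n j) = cos a"
    using cos_abs_real[of "(real k - 1 - 2 * real j) * pi / real n"]
    by (simp add: shift_root_def a_def abs_mult)
  have Rl: "Re (shift_root k n l) = cos b"
    using cos_minus[of b] by (simp add: shift_root_def b_def minus_divide_left algebra_simps)
  have n: "real n > 0" using assms by simp
  have a0: "0 \<le> a" by (simp add: a_def)
  have ab: "a < b"
    unfolding a_def b_def using assms by (intro divide_strict_right_mono mult_strict_right_mono) auto
  have ab': "a < 2 * pi - b"
  proof -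
    have "a < (2 * real n - (2 * real l + 1 - real k)) * pi / real n"
      unfolding a_def using assms by (intro divide_strict_right_mono mult_strict_right_mono) auto
    also have "\<dots> = 2 * pi - b" using n by (simp add: b_def field_simps)
    finally show ?thesis .
  qed
  show ?thesis
  proof (cases "b \<le> pi")
    case True
    then show ?thesis using cos_monotone_0_pi[OF a0 ab] Rj Rl by simp
  next
    case False
    then have "cos (2 * pi - b) < cos a" using cos_monotone_0_pi[OF a0 ab'] by simp
    then show ?thesis using Rj Rl by (simp add: cos_diff)
  qed
qed

text \<open>Every root in \<open>Z0\<close> is strictly closer to 1 than every root outside, so
  there are no ties. A different set of the same size contains some \<open>w\<close> outside
  \<open>Z0\<close> and misses some \<open>z\<close> in \<open>Z0\<close>, which contradicts its own
  minimality.\<close>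

lemma closest_sign_roots_iff:
  assumes n: "n \<ge> 1" and k: "k \<le> n"
  shows "closest_sign_roots k n Z \<longleftrightarrow> Z = shift_root k n ` {..<k}"
proof -
  define Z0 where "Z0 = shift_root k n ` {..<k}"
  have Z0: "Z0 \<subseteq> sign_roots k n" "card Z0 = k" "finite Z0"
    using shift_root_mem[OF n] card_shift_root_image[OF n k] by (auto simp: Z0_def)
  have less: "dist z 1 < dist w 1" if z: "z \<in> Z0" and w: "w \<in> sign_roots k n - Z0" for z w
  proof -
    obtain j where j: "z = shift_root k n j" "j < k" using z by (auto simp: Z0_def)
    obtain l where l: "w = shift_root k n l" "l < n"
      using w unfolding sign_roots_eq_image[OF n] by auto
    have "\<not> l < k" using w l by (auto simp: Z0_def)
    then have "Re w < Re z" using Re_shift_root_less[of j k l n] j l by simp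
    then show ?thesis
      using norm_sign_root[OF n] z w Z0 by (subst dist_1_less_iff) auto
  qed
  show ?thesis
    unfolding Z0_def[symmetric]
  proof
    assume Z: "closest_sign_roots k n Z"
    show "Z = Z0"
    proof (rule ccontr)
      assume ne: "Z \<noteq> Z0"
      have fin: "finite Z"
        using Z finite_sign_roots[OF n] finite_subset unfolding closest_sign_roots_def by blast
      have card: "card Z = card Z0" using Z Z0 by (simp add: closest_sign_roots_def)
      obtain w where w: "w \<in> Z" "w \<notin> Z0" using card_subset_eq[of Z0 Z] Z0 card ne by blast
      obtain z where z: "z \<in> Z0" "z \<notin> Z" using card_subset_eq[of Z Z0] fin card ne by auto
      have "dist w 1 \<le> dist z 1" "w \<in> sign_roots k n" 
        using Z w z Z0 unfolding closest_sign_roots_def by blast+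
      then show False using less[of z w] z w by auto
    qed
  next
    assume "Z = Z0"
    then show "closest_sign_roots k n Z"
      unfolding closest_sign_roots_def using Z0 less by (auto intro: less_imp_le)
  qed
qed

section \<open>Pluecker coordinates of the root matrix\<close>

lemma prod_pairs:
  fixes u :: "nat \<Rightarrow> 'a :: comm_semiring_1"
  shows "(\<Prod>l<k. \<Prod>m<l. u l * u m) = (\<Prod>l<k. u l ^ (k - 1))"
proof (induction k)
  case (Suc k)
  \<comment> \<open>The new index \<open>k\<close> pairs once with each smaller one, which raises
    every old exponent by one and gives \<open>u k\<close> the exponent \<open>k\<close>.\<close>
  have "(\<Prod>l<k. u l ^ (k - 1)) * (\<Prod>m<k. u k * u m) = (\<Prod>l<k. u l ^ (k - 1) * u l) * u k ^ k"
    by (simp add: prod.distrib mult_ac)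
  \<comment> \<open>Here \<open>l < k\<close> forces \<open>k > 0\<close>, so the truncated
    \<open>k - 1\<close> is a true predecessor.\<close>
  also have "(\<Prod>l<k. u l ^ (k - 1) * u l) = (\<Prod>l<k. u l ^ k)"
    by (intro prod.cong) (auto simp flip: power_Suc2)
  finally show ?case by (simp add: Suc)
qed simp

definition root_mat :: "nat \<Rightarrow> nat \<Rightarrow> complex mat" where
  "root_mat k n = mat k n (\<lambda>(j, i). shift_root k n j ^ i)"

lemma root_mat_carrier: "root_mat k n \<in> carrier_mat k n"
  by (simp add: root_mat_def)

text \<open>One factor \<open>- 2 * \<i>\<close> for each pair of columns, from writing a difference
  of exponentials as a sine. It is the same for all column sets of size \<open>k\<close>.\<close>

definition plucker_scale :: "nat \<Rightarrow> complex" where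
  "plucker_scale k = (\<Prod>l<k. \<Prod>m<l. - 2 * \<i>)"

lemma plucker_scale_nonzero: "plucker_scale k \<noteq> 0"
  by (simp add: plucker_scale_def)

text \<open>Column \<open>a\<close> of the root matrix is, up to a phase, a column of the Vandermonde matrix in the
  points \<open>exp (- 2 \<pi> \<i> a / n)\<close>. The differences of these points are sines up to phases, and all
  the phases cancel.\<close>

lemma plucker_root_mat:
  assumes n: "n \<ge> 1" and I: "I \<subseteq> {..<n}" "card I = k"
  shows "plucker (root_mat k n) I = plucker_scale k *
    of_real (\<Prod>l<k. \<Prod>m<l. sin ((real (pick I l) - real (pick I m)) * pi / real n))"
proof -
  define a where "a l = real (pick I l)" for l
  \<comment> \<open>Half the angle of \<open>x l\<close>, so that \<open>u l * u m\<close> is the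
    phase split off from \<open>x l - x m\<close>.\<close>
  define u where "u l = cis (- (a l * pi / real n))" for l
  \<comment> \<open>The factor common to column \<open>pick I l\<close> of the root matrix, whose
    entries are \<open>c l\<close> times powers of \<open>x l\<close>.\<close>
  define c where "c l = cis ((real k - 1) * (a l * pi / real n))" for l
  define x where "x l = cis (- (2 * (a l * pi / real n)))" for l
  have diff: "x l - x m = (u l * u m) * (- 2 * \<i> * of_real (sin ((a l - a m) * pi / real n)))" for l m
  proof -
    have d: "(a l - a m) * pi / real n = a l * pi / real n - a m * pi / real n"
      by (simp add: algebra_simps diff_divide_distrib)
    define s where "s = a l * pi / real n"
    define t where "t = a m * pi / real n"
    have "- 2 * \<i> * of_real (sin (s - t)) = cis (- (s - t)) - cis (s - t)"
      by (simp add: complex_eq_iff cos_diff sin_diff)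
    moreover have "cis (- s) * cis (- t) * (cis (- (s - t)) - cis (s - t)) = cis (- (2 * s)) - cis (- (2 * t))"
      by (simp add: right_diff_distrib cis_mult)
    ultimately show ?thesis
      unfolding d x_def u_def s_def t_def by simp
  qed
  have "submatrix (root_mat k n) UNIV I = mat k k (\<lambda>(j, l). c l * mat k k (\<lambda>(j, l). x l ^ j) $$ (j, l))"
  proof -
    have "pick I l < n" if "l < k" for l
      using pick_in_set_le[of l I] that I by auto
    moreover have "shift_root k n j ^ pick I l = c l * x l ^ j" for j l
      by (simp add: shift_root_def DeMoivre c_def x_def cis_mult a_def algebra_simps
          diff_divide_distrib add_divide_distrib)
    ultimately show ?thesis
      unfolding submatrix_UNIV_cols[OF root_mat_carrier I(1)] I(2)
      by (intro eq_matI) (auto simp: root_mat_def)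
  qed
  then have "plucker (root_mat k n) I = (\<Prod>l<k. c l) * (\<Prod>l<k. \<Prod>m<l. x l - x m)"
    unfolding plucker_def by (simp only: det_scale_cols[OF mat_carrier] det_vandermonde)
  also have "(\<Prod>l<k. \<Prod>m<l. x l - x m) = (\<Prod>l<k. u l ^ (k - 1)) *
    (plucker_scale k * of_real (\<Prod>l<k. \<Prod>m<l. sin ((a l - a m) * pi / real n)))"
    unfolding diff plucker_scale_def prod_pairs[symmetric]
    by (simp only: prod.distrib of_real_prod mult.assoc)
  also have "(\<Prod>l<k. c l) * ((\<Prod>l<k. u l ^ (k - 1)) *
    (plucker_scale k * of_real (\<Prod>l<k. \<Prod>m<l. sin ((a l - a m) * pi / real n)))) =
    (\<Prod>l<k. c l * u l ^ (k - 1)) *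
    (plucker_scale k * of_real (\<Prod>l<k. \<Prod>m<l. sin ((a l - a m) * pi / real n)))"
    by (simp only: prod.distrib mult.assoc)
  \<comment> \<open>The angle of \<open>c l\<close> is \<open>k - 1\<close> times the negative of
    the angle of \<open>u l\<close>; since \<open>l < k\<close>, the real and the natural
    \<open>k - 1\<close> agree.\<close>
  also have "(\<Prod>l<k. c l * u l ^ (k - 1)) = 1"
    by (rule prod.neutral) (auto simp: c_def u_def DeMoivre cis_mult of_nat_diff algebra_simps)
  finally show ?thesis by (simp add: a_def)
qed

text \<open>\<open>pick\<close> is increasing with values below \<open>n\<close>, so each difference
  lies strictly between 0 and \<open>n\<close> and each angle strictly between 0 and
  \<open>pi\<close>.\<close>

lemma sin_prod_pick_pos:
  assumes I: "I \<subseteq> {..<n}" "card I = k"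
  shows "(\<Prod>l<k. \<Prod>m<l. sin ((real (pick I l) - real (pick I m)) * pi / real n)) > 0"
proof (intro prod_pos ballI)
  fix l m assume lm: "l \<in> {..<k}" "m \<in> {..<l}"
  have less: "pick I m < pick I l" using pick_mono_le[of l I m] lm I by simp
  have "pick I l < n" using pick_in_set_le[of l I] lm I by auto
  then show "sin ((real (pick I l) - real (pick I m)) * pi / real n) > 0"
    using less by (intro sin_gt_zero) (auto simp: pos_divide_less_eq)
qed

lemma represents_root_mat:
  "represents k n (root_mat k n) (power_span n (shift_root k n ` {..<k}))"
proof -
  have "row (root_mat k n) j = moment_vec n (shift_root k n j)" if "j < k" for j
    using that by (intro eq_vecI) (auto simp: root_mat_def)
  then have "set (rows (root_mat k n)) = moment_vec n ` shift_root k n ` {..<k}"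
    using root_mat_carrier[of k n] by (auto simp: rows_def)
  then show ?thesis
    using root_mat_carrier by (simp add: represents_def vec_space.row_space_def power_span_def)
qed

lemma totally_nonneg_power_span:
  assumes n: "n \<ge> 1"
  shows "totally_nonneg k n (power_span n (shift_root k n ` {..<k}))"
  unfolding totally_nonneg_def
proof (intro exI conjI allI impI)
  show "represents k n (root_mat k n) (power_span n (shift_root k n ` {..<k}))"
    by (rule represents_root_mat)
  show "inverse (plucker_scale k) \<noteq> 0" using plucker_scale_nonzero by simp
  fix I assume "I \<subseteq> {..<n} \<and> card I = k"
  then have I: "I \<subseteq> {..<n}" "card I = k" by auto
  have "inverse (plucker_scale k) * plucker (root_mat k n) I =
    of_real (\<Prod>l<k. \<Prod>m<l. sin ((real (pick I l) - real (pick I m)) * pi / real n))"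
    unfolding plucker_root_mat[OF n I] using plucker_scale_nonzero by simp
  then show "inverse (plucker_scale k) * plucker (root_mat k n) I \<in> \<real>\<^sub>\<ge>\<^sub>0"
    using sin_prod_pick_pos[OF I] by (simp only: nonneg_Reals_of_real_iff less_imp_le)
qed

section \<open>Uniqueness of the totally nonnegative fixed point\<close>

lemma mult_mat_vec_eq_0_imp_orthogonal:
  fixes A :: "'a :: field mat"
  assumes A: "A \<in> carrier_mat k n" and u: "u \<in> carrier_vec n" and Au: "A *\<^sub>v u = 0\<^sub>v k"
    and v: "v \<in> vec_space.row_space n A"
  shows "v \<bullet> u = 0"
proof -
  interpret vec_space "TYPE('a)" n .
  have carr: "set (rows A) \<subseteq> carrier_vec n" using A rows_carrier[of A] by auto
  have "row A i \<bullet> u = 0" if "i < k" for i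
    using that A arg_cong[OF Au, of "\<lambda>x. x $ i"] by simp
  then have "u \<in> orthogonal_complement (set (rows A))"
    using A u carr by (auto simp: orthogonal_complement_def rows_def comm_scalar_prod[OF u])
  then have "u \<in> orthogonal_complement (span (set (rows A)))"
    using in_orthogonal_complement_span[OF carr] by simp
  moreover have "v \<in> carrier_vec n"
    using v span_closed[OF carr] by (simp add: row_space_def)
  ultimately show ?thesis
    using v comm_scalar_prod[OF u, of v] by (auto simp: orthogonal_complement_def row_space_def)
qed

text \<open>Pairing the rows of \<open>A\<close> with the eigenvectors for \<open>Y\<close> gives an
  invertible matrix \<open>A * D\<close>; by the Cauchy--Binet sum some minor of \<open>A\<close> is
  then nonzero.\<close>

lemma det_cols_nonzero:
  assumes n: "n \<ge> 1" and Y: "Y \<subseteq> sign_roots k n" "card Y = k"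
    and A: "represents k n A (power_span n Y)"
  obtains f where "f \<in> {..<k} \<rightarrow>\<^sub>E {..<n}" "det (mat k k (\<lambda>(i, j). A $$ (i, f j))) \<noteq> 0"
proof -
  have Ac: "A \<in> carrier_mat k n" and row: "vec_space.row_space n A = power_span n Y"
    using A by (auto simp: represents_def)
  have "finite Y" using Y finite_sign_roots[OF n] finite_subset by blast
  then obtain y where y: "bij_betw y {..<k} Y"
    using ex_bij_betw_nat_finite[of Y] Y lessThan_atLeast0 by metis
  have yR: "y j \<in> sign_roots k n" if "j < k" for j
    using bij_betw_apply[OF y] Y that by auto
  define D where "D = mat n k (\<lambda>(i, j). cnj (y j) ^ i)"
  have D: "D \<in> carrier_mat n k" by (simp add: D_def)
  have "det (A * D) \<noteq> 0"
  proof
    assume "det (A * D) = 0"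
    then obtain v where v: "v \<in> carrier_vec k" "v \<noteq> 0\<^sub>v k" "(A * D) *\<^sub>v v = 0\<^sub>v k"
      using det_0_iff_vec_prod_zero[of "A * D" k] Ac D by auto
    define u where "u = D *\<^sub>v v"
    have u: "u \<in> carrier_vec n" using D v by (auto simp: u_def)
    have Au: "A *\<^sub>v u = 0\<^sub>v k" using v assoc_mult_mat_vec[OF Ac D v(1)] by (simp add: u_def)
    \<comment> \<open>The vector \<open>u = D v\<close> is orthogonal to the row space of
      \<open>A\<close>, which contains the eigenvector of \<open>y l\<close>. Pairing the two leaves
      \<open>n\<close> times \<open>v $ l\<close>.\<close>
    have "v $ l = 0" if l: "l < k" for l
    proof -
      have "y l \<in> Y" using bij_betw_apply[OF y] l by auto
      then have "moment_vec n (y l) \<in> power_span n Y"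
        using moment_vec_mem_power_span_iff[OF n Y(1) yR[OF l]] by simp
      then have "0 = moment_vec n (y l) \<bullet> u"
        using mult_mat_vec_eq_0_imp_orthogonal[OF Ac u Au] row by simp
      also have "\<dots> = (\<Sum>i<n. \<Sum>j<k. v $ j * (y l * cnj (y j)) ^ i)"
        using v(1) by (simp add: u_def D_def scalar_prod_def lessThan_atLeast0 sum_distrib_left
            power_mult_distrib mult_ac)
      also have "\<dots> = (\<Sum>j<k. v $ j * (\<Sum>i<n. (y l * cnj (y j)) ^ i))"
        by (subst sum.swap) (simp add: sum_distrib_left)
      also have "\<dots> = (\<Sum>j<k. if j = l then v $ j * of_nat n else 0)"
        using sign_roots_orthogonal[OF n yR[OF l] yR] bij_betw_imp_inj_on[OF y] l
        by (intro sum.cong) (auto dest: inj_onD)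
      also have "\<dots> = v $ l * of_nat n" using l by simp
      finally show ?thesis using n by simp
    qed
    then have "v = 0\<^sub>v k" using v(1) by (intro eq_vecI) auto
    then show False using v(2) by simp
  qed
  then have "(\<Sum>f\<in>{..<k} \<rightarrow>\<^sub>E {..<n}. det (mat k k (\<lambda>(i, j). A $$ (i, f j))) *
    det (mat k k (\<lambda>(i, j). D $$ (f i, j)))) \<noteq> 0"
    unfolding det_mult_sum_PiE[OF Ac D] by simp
  then obtain f where "f \<in> {..<k} \<rightarrow>\<^sub>E {..<n}"
    "det (mat k k (\<lambda>(i, j). A $$ (i, f j))) * det (mat k k (\<lambda>(i, j). D $$ (f i, j))) \<noteq> 0"
    by (rule sum.not_neutral_contains_not_neutral)
  then show thesis using that[of f] by simp
qed

lemma det_noninj_cols: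
  fixes A :: "'a :: comm_ring_1 mat"
  assumes "\<not> inj_on f {..<k}"
  shows "det (mat k k (\<lambda>(i, j). A $$ (i, f j))) = 0"
proof -
  obtain i j where ij: "i < k" "j < k" "i \<noteq> j" "f i = f j"
    using assms by (auto simp: inj_on_def)
  have "col (mat k k (\<lambda>(i, j). A $$ (i, f j))) i = col (mat k k (\<lambda>(i, j). A $$ (i, f j))) j"
    using ij by (intro eq_vecI) auto
  then show ?thesis
    using ij by (intro det_identical_columns[of _ k i j]) auto
qed

lemma comm_ring_hom_cnj: "comm_ring_hom cnj"
  by unfold_locales auto

lemma det_map_cnj: "det (map_mat cnj A) = cnj (det A)"
  by (rule comm_ring_hom.hom_det[OF comm_ring_hom_cnj])

text \<open>Column \<open>j\<close> of the second factor is the conjugate eigenvector of a root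
  outside \<open>Y\<close>, orthogonal to all rows of \<open>A\<close>. The product thus has a zero
  column and sends \<open>unit_vec k j\<close> to zero.\<close>

lemma det_mult_orthogonal_eq_0:
  assumes n: "n \<ge> 1" and Y: "Y \<subseteq> sign_roots k n" and A: "represents k n A (power_span n Y)"
    and x: "x j \<in> sign_roots k n - Y" and j: "j < k"
  shows "det (A * mat n k (\<lambda>(i, j). cnj (x j) ^ i)) = 0"
proof -
  interpret vec_space "TYPE(complex)" n .
  have Ac: "A \<in> carrier_mat k n" and row: "row_space A = power_span n Y"
    using A by (auto simp: represents_def)
  define B where "B = mat n k (\<lambda>(i, j). cnj (x j) ^ i)"
  have B: "B \<in> carrier_mat n k" by (simp add: B_def)
  have u: "unit_vec k j \<in> carrier_vec k" by simp
  have Bu: "B *\<^sub>v unit_vec k j = moment_vec n (cnj (x j))"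
    using j by (intro eq_vecI) (auto simp: B_def)
  have carr: "set (rows A) \<subseteq> carrier_vec n" using Ac rows_carrier[of A] by auto
  have "A *\<^sub>v moment_vec n (cnj (x j)) = 0\<^sub>v k"
  proof (rule eq_vecI)
    fix i assume "i < dim_vec (0\<^sub>v k :: complex vec)"
    then have i: "i < k" by simp
    have "row A i \<in> power_span n Y"
      using in_own_span[OF carr] row i Ac by (auto simp: row_space_def rows_def)
    then have "row A i \<bullet> moment_vec n (cnj (x j)) = 0"
      using power_span_orthogonal[OF n Y x] by blast
    then show "(A *\<^sub>v moment_vec n (cnj (x j))) $ i = 0\<^sub>v k $ i"
      using i Ac by simp
  qed (use Ac in simp)
  then have ABu: "(A * B) *\<^sub>v unit_vec k j = 0\<^sub>v k"
    unfolding assoc_mult_mat_vec[OF Ac B u] Bu .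
  have "det (A * B) = 0"
    unfolding det_0_iff_vec_prod_zero[OF mult_carrier_mat[OF Ac B]]
    using j u ABu by (intro exI[of _ "unit_vec k j"] conjI) (simp_all only: unit_vec_nonzero not_False_eq_True)
  then show ?thesis by (simp add: B_def)
qed

lemma totally_nonneg_power_span_unique:
  assumes n: "n \<ge> 1" and k: "k \<le> n" and Y: "Y \<subseteq> sign_roots k n" "card Y = k"
    and tnn: "totally_nonneg k n (power_span n Y)"
  shows "Y = shift_root k n ` {..<k}"
proof (rule ccontr)
  assume ne: "Y \<noteq> shift_root k n ` {..<k}"
  have finY: "finite Y" using Y finite_sign_roots[OF n] finite_subset by blast
  obtain j where j: "j < k" "shift_root k n j \<notin> Y"
    using card_subset_eq[OF finY, of "shift_root k n ` {..<k}"] card_shift_root_image[OF n k] Y ne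
    by auto
  obtain A c where A: "represents k n A (power_span n Y)" and c: "c \<noteq> 0"
    and nn: "\<And>I. I \<subseteq> {..<n} \<Longrightarrow> card I = k \<Longrightarrow> c * plucker A I \<in> \<real>\<^sub>\<ge>\<^sub>0"
    using tnn unfolding totally_nonneg_def by blast
  have Ac: "A \<in> carrier_mat k n" and row: "vec_space.row_space n A = power_span n Y"
    using A by (auto simp: represents_def)
  \<comment> \<open>The conjugate transpose of the root matrix, so that \<open>det (A * B)\<close>
    is the Hermitian product of the two Pluecker vectors.\<close>
  define B where "B = mat n k (\<lambda>(i, j). cnj (shift_root k n j) ^ i)"
  have B: "B \<in> carrier_mat n k" by (simp add: B_def)
  have "shift_root k n j \<in> sign_roots k n - Y" using shift_root_mem[OF n] j by auto
  then have det0: "det (A * B) = 0"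
    unfolding B_def by (rule det_mult_orthogonal_eq_0[OF n Y(1) A _ j(1)])
  define r where "r I = (\<Prod>l<k. \<Prod>m<l. sin ((real (pick I l) - real (pick I m)) * pi / real n))" for I
  have rpos: "r I > 0" if "I \<subseteq> {..<n}" "card I = k" for I
    unfolding r_def by (rule sin_prod_pick_pos[OF that])
  let ?F = "{..<k} \<rightarrow>\<^sub>E {..<n}"
  define T where "T f = det (mat k k (\<lambda>(i, j). A $$ (i, f j))) * det (mat k k (\<lambda>(i, j). B $$ (f i, j)))" for f
  \<comment> \<open>Chosen to cancel the conjugated common scalar of the positive point:
    \<open>d * T f\<close> becomes a nonnegative coordinate of \<open>A\<close>, scaled by
    \<open>c\<close>, times a positive sine product.\<close>
  define d where "d = c * inverse (cnj (plucker_scale k))"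
  have d: "d \<noteq> 0" using c plucker_scale_nonzero by (simp add: d_def)
  have T: "d * T f = (c * plucker A (f ` {..<k})) * of_real (r (f ` {..<k}))"
    if f: "f \<in> ?F" "inj_on f {..<k}" for f
  proof -
    let ?I = "f ` {..<k}"
    have I: "?I \<subseteq> {..<n}" "card ?I = k" using f by (auto simp: card_image)
    have "f \<in> {..<k} \<rightarrow> {..<n}" using f by auto
    from det_cols_eq_signof_plucker[OF this f(2)] obtain p where
      "\<forall>M\<in>carrier_mat k n. det (mat k k (\<lambda>(i, j). M $$ (i, f j))) = signof p * plucker M ?I"
      by (elim exE conjE)
    note p = this[THEN bspec]
    have "mat k k (\<lambda>(i, j). B $$ (f i, j)) =
      transpose_mat (map_mat cnj (mat k k (\<lambda>(i, j). root_mat k n $$ (i, f j))))"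
    proof (rule eq_matI, goal_cases)
      case (1 i l)
      then have "i < k" "l < k" "f i < n" using f(1) by auto
      then show ?case by (simp add: B_def root_mat_def)
    qed simp_all
    then have "det (mat k k (\<lambda>(i, j). B $$ (f i, j))) =
      cnj (det (mat k k (\<lambda>(i, j). root_mat k n $$ (i, f j))))"
      by (simp add: det_transpose[of _ k] det_map_cnj)
    also have "\<dots> = signof p * (cnj (plucker_scale k) * of_real (r ?I))"
      unfolding p[OF root_mat_carrier] plucker_root_mat[OF n I] r_def by (simp add: sign_def)
    finally have "T f = signof p * signof p * (plucker A ?I * (cnj (plucker_scale k) * of_real (r ?I)))"
      unfolding T_def p[OF Ac] by (simp only: mult_ac)
    also have "signof p * signof p = (1 :: complex)" by (simp add: sign_def)
    finally show ?thesis using plucker_scale_nonzero by (simp add: d_def)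
  qed
  have T0: "T f = 0" if "\<not> inj_on f {..<k}" for f
    using det_noninj_cols[OF that, of A] by (simp add: T_def)
  have dT: "d * T f \<in> \<real>\<^sub>\<ge>\<^sub>0" if f: "f \<in> ?F" for f
  proof (cases "inj_on f {..<k}")
    case True
    then have I: "f ` {..<k} \<subseteq> {..<n}" "card (f ` {..<k}) = k" using f by (auto simp: card_image)
    show ?thesis
      unfolding T[OF f True] using nn[OF I] rpos[OF I]
      by (intro nonneg_Reals_mult_I[of "_ * _"]) auto
  qed (simp add: T0)
  obtain g where g: "g \<in> ?F" "det (mat k k (\<lambda>(i, j). A $$ (i, g j))) \<noteq> 0"
    using det_cols_nonzero[OF n Y A] by blast
  have inj: "inj_on g {..<k}" using det_noninj_cols[of g k A] g by blast
  have Ig: "g ` {..<k} \<subseteq> {..<n}" "card (g ` {..<k}) = k" using g inj by (auto simp: card_image)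
  have "plucker A (g ` {..<k}) \<noteq> 0"
  proof
    assume 0: "plucker A (g ` {..<k}) = 0"
    have "g \<in> {..<k} \<rightarrow> {..<n}" using g by auto
    from det_cols_eq_signof_plucker[OF this inj] obtain p where
      "\<forall>M\<in>carrier_mat k n. det (mat k k (\<lambda>(i, j). M $$ (i, g j))) = signof p * plucker M (g ` {..<k})"
      by (elim exE conjE)
    from this[THEN bspec, OF Ac] show False using 0 g(2) by simp
  qed
  then have "d * T g \<noteq> 0"
    unfolding T[OF g(1) inj] using c rpos[OF Ig] by simp
  then have "Re (d * T g) > 0"
    using dT[OF g(1)] by (auto simp: complex_nonneg_Reals_iff complex_eq_iff order_less_le)
  \<comment> \<open>All summands are nonnegative and the one at \<open>g\<close> is positive, yet
    the total is \<open>d\<close> times a multiple of \<open>det (A * B) = 0\<close>.\<close>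
  then have "0 < (\<Sum>f\<in>?F. Re (d * T f))"
    using dT g(1) by (intro sum_pos2[of _ g]) (auto simp: complex_nonneg_Reals_iff intro: finite_PiE)
  also have "\<dots> = Re (d * (\<Sum>f\<in>?F. T f))"
    by (simp add: sum_distrib_left)
  also have "(\<Sum>f\<in>?F. T f) = 0"
    unfolding T_def det_mult_sum_PiE[OF Ac B] det0 by simp
  finally show False by simp
qed

theorem theorem1p1:
  fixes n k :: nat
  assumes "n \<ge> 1" and "k \<le> n"
  shows "card (shift_fixed_points k n) = n choose k \<and>
    shift_fixed_points k n = {power_span n Z | Z. Z \<subseteq> sign_roots k n \<and> card Z = k} \<and>
    (let Z\<^sub>0 = {exp (\<i> * complex_of_real ((real k - 1 - 2 * real j) * pi / real n)) | j. j < k}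
     in {V \<in> shift_fixed_points k n. totally_nonneg k n V} = {power_span n Z\<^sub>0} \<and>
        (\<forall>Z. closest_sign_roots k n Z \<longleftrightarrow> Z = Z\<^sub>0))"
proof -
  define Z0 where "Z0 = {exp (\<i> * complex_of_real ((real k - 1 - 2 * real j) * pi / real n)) | j. j < k}"
  have Z0: "Z0 = shift_root k n ` {..<k}"
    by (auto simp: Z0_def shift_root_def cis_conv_exp)
  have mem: "power_span n Z0 \<in> shift_fixed_points k n"
    unfolding shift_fixed_points_eq[OF assms(1)] Z0
    using shift_root_mem[OF assms(1)] card_shift_root_image[OF assms] by blast
  have "{V \<in> shift_fixed_points k n. totally_nonneg k n V} = {power_span n Z0}"
  proof (intro equalityI subsetI)
    fix V assume "V \<in> {V \<in> shift_fixed_points k n. totally_nonneg k n V}"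
    then obtain Y where "Y \<subseteq> sign_roots k n" "card Y = k" "V = power_span n Y" "totally_nonneg k n V"
      unfolding shift_fixed_points_eq[OF assms(1)] by blast
    then show "V \<in> {power_span n Z0}"
      using totally_nonneg_power_span_unique[OF assms, of Y] by (simp add: Z0)
  next
    fix V assume "V \<in> {power_span n Z0}"
    then show "V \<in> {V \<in> shift_fixed_points k n. totally_nonneg k n V}"
      using mem totally_nonneg_power_span[OF assms(1), of k] by (simp add: Z0)
  qed
  moreover have "\<forall>Z. closest_sign_roots k n Z \<longleftrightarrow> Z = Z0"
    using closest_sign_roots_iff[OF assms] by (simp add: Z0)
  ultimately show ?thesis
    unfolding Z0_def[symmetric] Let_def
    using card_shift_fixed_points[OF assms(1)] shift_fixed_points_eq[OF assms(1)]
    by (intro conjI)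
qed

end
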